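(* Let $q,k\in\mathbb{N}$ and let $\mathcal{F}\subseteq\{f:[q]^k\to\{0,1\}\}$ be a finite predicate family that weakly supports one-wise independence. Then for every $\epsilon>0$ there exists a $(1,\rho(\mathcal{F})+\epsilon)$-integrality gap instance for the basic LP for $\textsc{Max-CSP}(\mathcal{F})$, i.e., there is an instance $\Phi$ of $\textsc{Max-CSP}(\mathcal{F})$ with $\mathrm{opt}^{\mathrm{CSP}}_\Phi\le\rho(\mathcal{F})+\epsilon$ and $\mathrm{opt}^{\mathrm{LP}}_\Phi\ge 1$.
   Context: An instance $\Phi$ of $\textsc{Max-CSP}(\mathcal{F})$ on variables $x_1,\dots,x_n$ (taking values in $[q]$) is a list of constraints $C_1,\dots,C_m$ with non-negative integer weights; each constraint is a pair $C=(f,\mathbf{j})$ with $f\in\mathcal{F}$ and $\mathbf{j}=(j_1,\dots,j_k)\in[n]^k$ having distinct coordinates. An assignment $\mathbf{b}\in[q]^n$ satisfies $C$ if $f(b_{j_1},\dots,b_{j_k})=1$; $\mathrm{val}^{\mathrm{CSP}}_\Phi(\mathbf{b})$ is the weighted fraction of constraints satisfied, and $\mathrm{opt}^{\mathrm{CSP}}_\Phi=\max_{\mathbf{b}\in[q]^n}\mathrm{val}^{\mathrm{CSP}}_\Phi(\mathbf{b})$. Define $\rho(\mathcal{F})=\lim_{n\to\infty}\inf\{\mathrm{opt}^{\mathrm{CSP}}_\Psi:\Psi\text{ an instance of }\textsc{Max-CSP}(\mathcal{F})\text{ on }n\text{ variables}\}$. Basic LP: a feasible solution for $\Phi$ is a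 tuple of local distributions $(Y_C\in\Delta([q]^k))_{C\in\Phi}$ together with $X_i\in\Delta([q])$ for $i\in[n]$ such that for every constraint $C=(f,\mathbf{j})$ and $\ell\in[k]$, the marginal of $Y_C$ on coordinate $\ell$ equals $X_{j_\ell}$. Its value is the weighted average over constraints $C=(f,\mathbf{j})$ of $\mathbb{E}_{\mathbf{a}\sim Y_C}[f(\mathbf{a})]$; $\mathrm{opt}^{\mathrm{LP}}_\Phi$ is the maximum value. A $(\gamma,\beta)$-integrality gap instance is an instance with $\mathrm{opt}^{\mathrm{CSP}}_\Phi\le\beta$ and $\mathrm{opt}^{\mathrm{LP}}_\Phi\ge\gamma$. A predicate $f:[q]^k\to\{0,1\}$ supports one-wise independence if there is a distribution $\mathcal{D}$ on $[q]^k$ supported on satisfying assignments of $f$ (i.e. $\mathbb{E}_{\mathbf{b}\sim\mathcal{D}}[f(\mathbf{b})]=1$) such that for every $\ell\in[k]$ and $\sigma\in[q]$, $\Pr_{\mathbf{b}\sim\mathcal{D}}[b_\ell=\sigma]=1/q$. A family $\mathcal{F}$ strongly supports one-wise independence if every $f\in\mathcal{F}$ does, and weakly supports one-wise independence if some subfamily $\mathcal{F}'\subseteq\mathcal{F}$ with $\rho(\mathcal{F}')=\rho(\mathcal{F})$ strongly supports one-wise independence. *)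

theory Defs
  imports "HOL-Probability.Probability"
begin

text \<open>
  The alphabet \<open>[q]\<close> and the index set \<open>[k]\<close> of the coordinates of a predicate are finite types
  \<open>'q\<close> and \<open>'k\<close>, so that \<open>q = CARD('q)\<close>, \<open>k = CARD('k)\<close>, both positive, and \<open>[q]\<^sup>k\<close> is the
  type \<open>'k \<Rightarrow> 'q\<close>. A \<open>{0,1}\<close>-valued predicate is Boolean-valued, with \<open>of_bool\<close> giving its numeric
  value. Every family of such predicates is finite.
\<close>

type_synonym ('k, 'q) predicate = "('k \<Rightarrow> 'q) \<Rightarrow> bool"

type_synonym ('k, 'q) "constraint" = "('k, 'q) predicate \<times> ('k \<Rightarrow> nat)"

text \<open>An instance on the variables \<open>1, \<dots>, nvars\<close>; every listed constraint comes with its weight.\<close>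

datatype ('k, 'q) csp_instance =
  CSP (nvars: nat) (wconstraints: "(('k, 'q) constraint \<times> nat) list")

definition total_weight :: "('k, 'q) csp_instance \<Rightarrow> nat" where
  "total_weight \<Phi> = (\<Sum>(C, w) \<leftarrow> wconstraints \<Phi>. w)"

text \<open>The total weight has to be positive for weighted fractions to be defined.\<close>

definition is_instance :: "('k, 'q) predicate set \<Rightarrow> ('k, 'q) csp_instance \<Rightarrow> bool" where
  "is_instance F \<Phi> \<longleftrightarrow>
     (\<forall>((f, j), w) \<in> set (wconstraints \<Phi>). f \<in> F \<and> inj j \<and> range j \<subseteq> {1..nvars \<Phi>}) \<and>
     total_weight \<Phi> > 0"

definition val_csp :: "('k, 'q) csp_instance \<Rightarrow> (nat \<Rightarrow> 'q) \<Rightarrow> real" where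
  "val_csp \<Phi> b =
     (\<Sum>((f, j), w) \<leftarrow> wconstraints \<Phi>. real w * of_bool (f (\<lambda>l. b (j l)))) / real (total_weight \<Phi>)"

definition opt_csp :: "('k, 'q :: finite) csp_instance \<Rightarrow> real" where
  "opt_csp \<Phi> = (MAX b \<in> {1..nvars \<Phi>} \<rightarrow>\<^sub>E UNIV. val_csp \<Phi> b)"

text \<open>
  The infimum is over a nonempty set as soon as \<open>F\<close> is nonempty and \<open>n \<ge> CARD('k)\<close>; the
  values for smaller \<open>n\<close> do not affect the limit, which exists by \<open>convergent_rho\<close> below.
\<close>

definition rho :: "('k :: finite, 'q :: finite) predicate set \<Rightarrow> real" where
  "rho F = lim (\<lambda>n. INF \<Psi> \<in> {\<Psi>. is_instance F \<Psi> \<and> nvars \<Psi> = n}. opt_csp \<Psi>)"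

text \<open>
  A solution of the basic LP consists of a local distribution \<open>Y i\<close> for the constraint at position
  \<open>i\<close> of the list and a distribution \<open>X v\<close> for each variable \<open>v\<close>; values of \<open>Y\<close> and \<open>X\<close> at other
  arguments play no role.
\<close>

definition lp_feasible ::
  "('k, 'q) csp_instance \<Rightarrow> (nat \<Rightarrow> ('k \<Rightarrow> 'q) pmf) \<Rightarrow> (nat \<Rightarrow> 'q pmf) \<Rightarrow> bool" where
  "lp_feasible \<Phi> Y X \<longleftrightarrow>
     (\<forall>i < length (wconstraints \<Phi>). case wconstraints \<Phi> ! i of ((f, j), w) \<Rightarrow>
        \<forall>l. map_pmf (\<lambda>a. a l) (Y i) = X (j l))"

definition val_lp :: "('k, 'q) csp_instance \<Rightarrow> (nat \<Rightarrow> ('k \<Rightarrow> 'q) pmf) \<Rightarrow> real" where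
  "val_lp \<Phi> Y =
     (\<Sum>i < length (wconstraints \<Phi>). case wconstraints \<Phi> ! i of ((f, j), w) \<Rightarrow>
        real w * measure_pmf.expectation (Y i) (\<lambda>a. of_bool (f a))) / real (total_weight \<Phi>)"

text \<open>The feasible set is a nonempty polytope, so this supremum is a maximum.\<close>

definition opt_lp :: "('k, 'q) csp_instance \<Rightarrow> real" where
  "opt_lp \<Phi> = Sup {val_lp \<Phi> Y | Y X. lp_feasible \<Phi> Y X}"

definition integrality_gap_instance ::
  "('k, 'q :: finite) predicate set \<Rightarrow> real \<Rightarrow> real \<Rightarrow> ('k, 'q) csp_instance \<Rightarrow> bool" where
  "integrality_gap_instance F \<gamma> \<beta> \<Phi> \<longleftrightarrow>
     is_instance F \<Phi> \<and> opt_csp \<Phi> \<le> \<beta> \<and> opt_lp \<Phi> \<ge> \<gamma>"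

definition supports_one_wise_independence :: "('k, 'q :: finite) predicate \<Rightarrow> bool" where
  "supports_one_wise_independence f \<longleftrightarrow>
     (\<exists>D :: ('k \<Rightarrow> 'q) pmf.
        measure_pmf.expectation D (\<lambda>b. of_bool (f b) :: real) = 1 \<and>
        (\<forall>l \<sigma>. measure_pmf.prob D {b. b l = \<sigma>} = 1 / real CARD('q)))"

definition strongly_supports_one_wise_independence ::
  "('k, 'q :: finite) predicate set \<Rightarrow> bool" where
  "strongly_supports_one_wise_independence F \<longleftrightarrow> (\<forall>f \<in> F. supports_one_wise_independence f)"

text \<open>
  The subfamily has to be nonempty: the empty family has no instances, so that \<open>rho {}\<close>
  carries no meaning.
\<close>

definition weakly_supports_one_wise_independence ::
  "('k :: finite, 'q :: finite) predicate set \<Rightarrow> bool" where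
  "weakly_supports_one_wise_independence F \<longleftrightarrow>
     (\<exists>F' \<subseteq> F. F' \<noteq> {} \<and> rho F' = rho F \<and> strongly_supports_one_wise_independence F')"

lemma opt_csp_nonneg: "opt_csp (\<Phi> :: ('k, 'q :: finite) csp_instance) \<ge> 0"
proof -
  let ?A = "{1..nvars \<Phi>} \<rightarrow>\<^sub>E (UNIV :: 'q set)"
  have fin: "finite ?A" by (intro finite_PiE) auto
  have "?A \<noteq> {}" by (simp add: PiE_eq_empty_iff)
  then obtain b where b: "b \<in> ?A" by blast
  have "0 \<le> val_csp \<Phi> b"
    unfolding val_csp_def by (intro divide_nonneg_nonneg sum_list_nonneg) auto
  also have "\<dots> \<le> opt_csp \<Phi>"
    unfolding opt_csp_def using fin b by (intro Max_ge) auto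
  finally show ?thesis .
qed

lemma exists_instance:
  fixes F :: "('k :: finite, 'q) predicate set"
  assumes "F \<noteq> {}" and n: "n \<ge> CARD('k)"
  shows "\<exists>\<Psi>. is_instance F \<Psi> \<and> nvars \<Psi> = n"
proof -
  obtain f where f: "f \<in> F" using assms by blast
  have "card (UNIV :: 'k set) \<le> card {1..n}" using n by simp
  then obtain j :: "'k \<Rightarrow> nat" where "inj j" "range j \<subseteq> {1..n}"
    using card_le_inj[of "UNIV :: 'k set" "{1..n}"] by auto
  then have "is_instance F (CSP n [((f, j), 1)])"
    using f by (auto simp: is_instance_def total_weight_def)
  then show ?thesis by (metis csp_instance.sel(1))
qed

text \<open>Adding a variable that occurs in no constraint.\<close>

lemma is_instance_Suc:
  assumes "is_instance F (CSP n cs)"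
  shows "is_instance F (CSP (Suc n) cs)"
proof -
  have "f \<in> F \<and> inj j \<and> range j \<subseteq> {1..Suc n}" if "((f, j), w) \<in> set cs" for f j w
  proof -
    have *: "f \<in> F" "inj j" "range j \<subseteq> {1..n}"
      using bspec[OF conjunct1[OF assms[unfolded is_instance_def]], of "((f, j), w)"] that by simp_all
    have "{1..n} \<subseteq> {1..Suc n}" by simp
    with * show ?thesis by (metis order_trans)
  qed
  moreover have "total_weight (CSP (Suc n) cs) > 0"
    using assms by (simp add: is_instance_def total_weight_def)
  ultimately show ?thesis unfolding is_instance_def csp_instance.sel by blast
qed

lemma opt_csp_Suc:
  fixes F :: "('k, 'q :: finite) predicate set"
  assumes "is_instance F (CSP n cs)"
  shows "opt_csp (CSP (Suc n) cs) \<le> opt_csp (CSP n cs)"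
proof -
  let ?A = "\<lambda>n::nat. {1..n} \<rightarrow>\<^sub>E (UNIV :: 'q set)"
  have fin: "finite (?A m)" for m by (intro finite_PiE) auto
  have ne: "?A m \<noteq> {}" for m by (simp add: PiE_eq_empty_iff)
  have "val_csp (CSP (Suc n) cs) b \<le> opt_csp (CSP n cs)" for b
  proof -
    let ?b = "restrict b {1..n}"
    have "val_csp (CSP (Suc n) cs) b = val_csp (CSP n cs) ?b"
    proof -
      have eq: "f (\<lambda>l. b (j l)) = f (\<lambda>l. ?b (j l))" if "((f, j), w) \<in> set cs" for f j w
      proof -
        have "range j \<subseteq> {1..n}"
          using bspec[OF conjunct1[OF assms[unfolded is_instance_def]], of "((f, j), w)"] that
          by simp
        then have "j l \<in> {1..n}" for l by blast
        then have "(\<lambda>l. b (j l)) = (\<lambda>l. ?b (j l))" by (auto simp: restrict_def)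
        then show ?thesis by simp
      qed
      let ?v = "\<lambda>b ((f, j), w). real w * of_bool (f (\<lambda>l. b (j l)))"
      have "?v b C = ?v ?b C" if "C \<in> set cs" for C
      proof -
        obtain f j w where C: "C = ((f, j), w)" by (metis surj_pair)
        show ?thesis unfolding C prod.case by (simp only: eq[OF that[unfolded C]])
      qed
      then have "map (?v b) cs = map (?v ?b) cs" by (rule list.map_cong0)
      then show ?thesis unfolding val_csp_def total_weight_def csp_instance.sel by (simp only:)
    qed
    also have "\<dots> \<le> opt_csp (CSP n cs)"
      unfolding opt_csp_def using fin by (intro Max_ge) auto
    finally show ?thesis .
  qed
  then show ?thesis
    using fin ne unfolding opt_csp_def[of "CSP (Suc n) cs"] by (subst Max_le_iff) auto
qed

lemma convergent_rho:
  fixes F :: "('k :: finite, 'q :: finite) predicate set"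
  assumes "F \<noteq> {}"
  shows "convergent (\<lambda>n. INF \<Psi> \<in> {\<Psi>. is_instance F \<Psi> \<and> nvars \<Psi> = n}. opt_csp \<Psi>)"
proof -
  define S where "S n = {\<Psi>. is_instance F \<Psi> \<and> nvars \<Psi> = n}" for n
  define g where "g n = (INF \<Psi> \<in> S n. opt_csp \<Psi>)" for n
  let ?K = "CARD('k)"
  have ne: "S n \<noteq> {}" if "n \<ge> ?K" for n
    using exists_instance[OF assms that] by (auto simp: S_def)
  have bdd: "bdd_below (opt_csp ` S n)" for n
    by (rule bdd_belowI[of _ 0]) (auto simp: opt_csp_nonneg)
  have step: "g (Suc n) \<le> g n" if n: "n \<ge> ?K" for n
    unfolding g_def
  proof (rule cINF_mono[OF ne[OF n] bdd])
    fix \<Psi> assume *: "\<Psi> \<in> S n"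
    obtain cs where \<Psi>: "\<Psi> = CSP n cs" using * by (cases \<Psi>) (auto simp: S_def)
    have inst: "is_instance F (CSP n cs)" using * \<Psi> by (simp add: S_def)
    then have "is_instance F (CSP (Suc n) cs)" by (rule is_instance_Suc)
    then show "\<exists>\<Psi>' \<in> S (Suc n). opt_csp \<Psi>' \<le> opt_csp \<Psi>"
      using opt_csp_Suc[OF inst] \<Psi> by (auto simp: S_def)
  qed
  have nonneg: "0 \<le> g (n + ?K)" for n
    unfolding g_def by (rule cINF_greatest[OF ne]) (auto simp: opt_csp_nonneg)
  have dec: "decseq (\<lambda>n. g (n + ?K))"
    using step by (simp add: decseq_Suc_iff)
  obtain L where "(\<lambda>n. g (n + ?K)) \<longlonglongrightarrow> L"
    using decseq_convergent[OF dec] nonneg by blast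
  then have "g \<longlonglongrightarrow> L" by (rule LIMSEQ_offset)
  then have "convergent g" by (rule convergentI)
  then show ?thesis by (simp add: g_def[abs_def] S_def)
qed

end

theory Submission
  imports Defs
begin

text \<open>
  The LP cannot see beyond the marginals of the local distributions. If every predicate of a
  subfamily \<open>F'\<close> has a distribution on its satisfying assignments with uniform marginals, then
  these distributions together with uniform \<open>X\<close> form a feasible solution of value 1 on \<^emph>\<open>every\<close>
  instance of \<open>F'\<close>. So any instance of \<open>F'\<close> whose optimum is within \<open>\<epsilon>\<close> of \<open>rho F' = rho F\<close> is
  the required gap instance.
\<close>

lemma is_instance_mono:
  assumes "is_instance F \<Phi>" "F \<subseteq> F'"
  shows "is_instance F' \<Phi>"
  using assms unfolding is_instance_def by (fastforce split: prod.splits)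

text \<open>Indexing the weights by position, as \<open>val_lp\<close> does, lets the LP objective
  be compared with the total weight term by term.\<close>

lemma real_total_weight:
  "real (total_weight \<Phi>) = (\<Sum>i < length (wconstraints \<Phi>). real (snd (wconstraints \<Phi> ! i)))"
  by (simp add: total_weight_def sum_list_sum_nth atLeast0LessThan case_prod_unfold)

text \<open>Gives the upper bound needed in \<open>opt_lp_ge\<close>: the real \<open>Sup\<close> in
  \<open>opt_lp\<close> dominates its members only once the set is known to be bounded
  above.\<close>

lemma val_lp_le_1:
  fixes \<Phi> :: "('k, 'q) csp_instance"
  shows "val_lp \<Phi> Y \<le> 1"
proof -
  have "measure_pmf.expectation p (\<lambda>a. of_bool (P a) :: real) \<le> 1" for p :: "('k \<Rightarrow> 'q) pmf" and P
    by (rule measure_pmf.integral_le_const)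
      (auto intro!: measure_pmf.integrable_const_bound[where B = 1])
  then have "(\<Sum>i < length (wconstraints \<Phi>). case wconstraints \<Phi> ! i of ((f, j), w) \<Rightarrow>
      real w * measure_pmf.expectation (Y i) (\<lambda>a. of_bool (f a))) \<le> real (total_weight \<Phi>)"
    unfolding real_total_weight
    by (intro sum_mono) (auto simp: case_prod_unfold intro: mult_left_le)
  then show ?thesis
    unfolding val_lp_def by (simp add: divide_le_eq)
qed

lemma opt_lp_ge:
  assumes "lp_feasible \<Phi> Y X"
  shows "val_lp \<Phi> Y \<le> opt_lp \<Phi>"
  unfolding opt_lp_def
  by (rule cSup_upper) (use assms val_lp_le_1 in \<open>auto intro!: bdd_aboveI[where M = 1]\<close>)

lemma opt_lp_ge_1:
  fixes F :: "('k, 'q :: finite) predicate set"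
  assumes inst: "is_instance F \<Phi>" and F: "strongly_supports_one_wise_independence F"
  shows "opt_lp \<Phi> \<ge> 1"
proof -
  obtain D :: "('k, 'q) predicate \<Rightarrow> ('k \<Rightarrow> 'q) pmf" where
    sat: "\<And>f. f \<in> F \<Longrightarrow> measure_pmf.expectation (D f) (\<lambda>b. of_bool (f b) :: real) = 1" and
    unif: "\<And>f l \<sigma>. f \<in> F \<Longrightarrow> measure_pmf.prob (D f) {b. b l = \<sigma>} = 1 / real CARD('q)"
    using F unfolding strongly_supports_one_wise_independence_def
      supports_one_wise_independence_def by metis
  \<comment> \<open>The local distribution depends only on the predicate of the constraint, not on
    its variables.\<close>
  define Y where "Y i = D (fst (fst (wconstraints \<Phi> ! i)))" for i
  have pred: "fst (fst (wconstraints \<Phi> ! i)) \<in> F" if "i < length (wconstraints \<Phi>)" for i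
    using inst nth_mem[OF that] unfolding is_instance_def by (fastforce split: prod.splits)
  \<comment> \<open>All marginals are the same distribution, so constraints sharing a variable
    automatically agree on it.\<close>
  have marginal: "map_pmf (\<lambda>a. a l) (D f) = pmf_of_set UNIV" if "f \<in> F" for f l
    by (rule pmf_eqI) (simp add: pmf_map vimage_def unif[OF that])
  have "lp_feasible \<Phi> Y (\<lambda>_. pmf_of_set UNIV)"
    unfolding lp_feasible_def Y_def by (auto simp: case_prod_unfold marginal pred)
  moreover have "val_lp \<Phi> Y = 1"
  proof -
    have "(\<Sum>i < length (wconstraints \<Phi>). case wconstraints \<Phi> ! i of ((f, j), w) \<Rightarrow>
        real w * measure_pmf.expectation (Y i) (\<lambda>a. of_bool (f a))) = real (total_weight \<Phi>)"
      unfolding real_total_weight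
      by (intro sum.cong) (auto simp: case_prod_unfold Y_def sat pred)
    then show ?thesis
      using inst unfolding val_lp_def is_instance_def by simp
  qed
  ultimately show ?thesis
    using opt_lp_ge by metis
qed

lemma exists_instance_opt_csp_less:
  fixes F :: "('k :: finite, 'q :: finite) predicate set"
  assumes "F \<noteq> {}" "rho F < c"
  shows "\<exists>\<Phi>. is_instance F \<Phi> \<and> opt_csp \<Phi> < c"
proof -
  define S where "S n = {\<Psi>. is_instance F \<Psi> \<and> nvars \<Psi> = n}" for n
  have "(\<lambda>n. INF \<Psi> \<in> S n. opt_csp \<Psi>) \<longlonglongrightarrow> rho F"
    using convergent_rho[OF assms(1)] unfolding rho_def S_def convergent_LIMSEQ_iff .
  then have "\<forall>\<^sub>F n in sequentially. (INF \<Psi> \<in> S n. opt_csp \<Psi>) < c"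
    using assms(2) by (rule order_tendstoD)
  \<comment> \<open>Taking \<open>n\<close> at least \<open>CARD('k)\<close> as well is essential:
    for smaller \<open>n\<close> no injective \<open>j\<close> exists, so there are no instances and
    the infimum is over the empty set.\<close>
  then obtain n where n: "n \<ge> CARD('k)" "(INF \<Psi> \<in> S n. opt_csp \<Psi>) < c"
    unfolding eventually_sequentially by (metis nle_le)
  have "S n \<noteq> {}"
    using exists_instance[OF assms(1) n(1)] by (auto simp: S_def)
  moreover have "bdd_below (opt_csp ` S n)"
    by (rule bdd_belowI[of _ 0]) (auto simp: opt_csp_nonneg)
  ultimately show ?thesis
    using n(2) by (auto simp: cINF_less_iff S_def)
qed

theorem theorem3p2:
  fixes F :: "('k :: finite, 'q :: finite) predicate set" and \<epsilon> :: real
  assumes "weakly_supports_one_wise_independence F"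
    and "\<epsilon> > 0"
  shows "\<exists>\<Phi>. integrality_gap_instance F 1 (rho F + \<epsilon>) \<Phi>"
proof -
  obtain F' where F': "F' \<subseteq> F" "F' \<noteq> {}" "rho F' = rho F"
      "strongly_supports_one_wise_independence F'"
    using assms(1) unfolding weakly_supports_one_wise_independence_def by blast
  \<comment> \<open>The instance comes from \<open>F'\<close>, not merely \<open>F\<close>, because
    the LP solution needs every occurring predicate to support one-wise independence; \<epsilon> > 0
    leaves room to get below the limit plus \<epsilon>.\<close>
  then obtain \<Phi> where \<Phi>: "is_instance F' \<Phi>" "opt_csp \<Phi> < rho F + \<epsilon>"
    using exists_instance_opt_csp_less[of F' "rho F + \<epsilon>"] assms(2) by auto
  then have "integrality_gap_instance F 1 (rho F + \<epsilon>) \<Phi>"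
    unfolding integrality_gap_instance_def
    using is_instance_mono[OF \<Phi>(1) F'(1)] opt_lp_ge_1[OF \<Phi>(1) F'(4)] by simp
  then show ?thesis ..
qed

end
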